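(* Let $P:\mathbf M\to\mathbf A$ be a bifibrant functor and let $a:A_1\to A_0$ and $a_1,a_2:A_2\to A_1$ be morphisms of $\mathbf A$ with $aa_1=aa_2$ (the resulting commutative square, with top $a_2$, left side $a_1$, right side $a$ and bottom $a$, is not assumed Cartesian). Then the following conditions are equivalent: (Exchange condition) the base change morphism $\chi:(a_2)_*a_1^*\Rightarrow a^*a_*$ is an isomorphism; (Chevalley condition (C)) for every commutative square in $\mathbf M$ $$\begin{array}{ccc} M_1' & \xrightarrow{\;k_1\;} & M_1\\ {\scriptstyle \chi'}\downarrow & & \downarrow{\scriptstyle \kappa}\\ M_0' & \xrightarrow{\;k_0\;} & M_0\end{array}$$ lying over the given square (i.e. $P(k_1)=a_2$, $P(\chi')=a_1$, $P(\kappa)=a$, $P(k_0)=a$), if $\kappa$ and $\chi'$ are Cartesian and $k_0$ is co-Cartesian, then $k_1$ is co-Cartesian.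
   Context: $P:\mathbf M\to\mathbf A$ bifibrant means a Grothendieck fibration and opfibration; $\mathbf M(A)$ is the fibre over $A\in\mathbf A$. For an arrow $f$ of $\mathbf A$, $f^*$ and $f_*$ are the inverse and direct image functors between fibres; $f_*$ is left adjoint to $f^*$, with unit $\eta^f:\mathrm{Id}\Rightarrow f^*f_*$ and counit $\epsilon^f:f_*f^*\Rightarrow\mathrm{Id}$. The assignment $f\mapsto f^*$ is assumed strictly functorial, and the left adjoints are chosen so that $f\mapsto f_*$ is strictly functorial. The base change morphism is $\chi=\epsilon^{a_2}a^*a_*\circ (a_2)_*a_1^*\eta^a$, using $a_1^*a^*=a_2^*a^*$. *)

theory Defs
  imports Main
begin

section \<open>Categories, functors, natural transformations\<close>

record ('o, 'm) cat =
  Obj :: "'o set"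
  Arr :: "'m set"
  src :: "'m \<Rightarrow> 'o"
  tgt :: "'m \<Rightarrow> 'o"
  ident :: "'o \<Rightarrow> 'm"
  cmp :: "'m \<Rightarrow> 'm \<Rightarrow> 'm" (infixl "\<cdot>\<index>" 70)

text \<open>\<open>g \<cdot> f\<close> is \<open>g\<close> after \<open>f\<close>.
  All operations are meaningful on the carriers \<open>Obj\<close> and \<open>Arr\<close> only.\<close>

definition hom :: "('o, 'm) cat \<Rightarrow> 'o \<Rightarrow> 'o \<Rightarrow> 'm set" where
  "hom C X Y = {u \<in> Arr C. src C u = X \<and> tgt C u = Y}"

locale category =
  fixes C :: "('o, 'm) cat" (structure)
  assumes src_obj: "u \<in> Arr C \<Longrightarrow> src C u \<in> Obj C"
    and tgt_obj: "u \<in> Arr C \<Longrightarrow> tgt C u \<in> Obj C"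
    and ident_hom: "X \<in> Obj C \<Longrightarrow> ident C X \<in> hom C X X"
    and cmp_hom: "u \<in> hom C X Y \<Longrightarrow> v \<in> hom C Y Z \<Longrightarrow> v \<cdot> u \<in> hom C X Z"
    and ident_right: "u \<in> hom C X Y \<Longrightarrow> u \<cdot> ident C X = u"
    and ident_left: "u \<in> hom C X Y \<Longrightarrow> ident C Y \<cdot> u = u"
    and cmp_assoc: "u \<in> hom C W X \<Longrightarrow> v \<in> hom C X Y \<Longrightarrow> w \<in> hom C Y Z \<Longrightarrow>
      (w \<cdot> v) \<cdot> u = w \<cdot> (v \<cdot> u)"

record ('o, 'm, 'p, 'q) func =
  fobj :: "'o \<Rightarrow> 'p"
  farr :: "'m \<Rightarrow> 'q"

definition is_functor ::
  "('o, 'm) cat \<Rightarrow> ('p, 'q) cat \<Rightarrow> ('o, 'm, 'p, 'q) func \<Rightarrow> bool" where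
  "is_functor C D F \<longleftrightarrow> category C \<and> category D \<and>
     (\<forall>X\<in>Obj C. fobj F X \<in> Obj D) \<and>
     (\<forall>u\<in>Arr C. farr F u \<in> hom D (fobj F (src C u)) (fobj F (tgt C u))) \<and>
     (\<forall>X\<in>Obj C. farr F (ident C X) = ident D (fobj F X)) \<and>
     (\<forall>u\<in>Arr C. \<forall>v\<in>Arr C. src C v = tgt C u \<longrightarrow>
        farr F (v \<cdot>\<^bsub>C\<^esub> u) = farr F v \<cdot>\<^bsub>D\<^esub> farr F u)"

definition id_func :: "('o, 'm, 'o, 'm) func" where
  "id_func = \<lparr>fobj = (\<lambda>X. X), farr = (\<lambda>u. u)\<rparr>"

definition comp_func ::
  "('p, 'q, 'r, 's) func \<Rightarrow> ('o, 'm, 'p, 'q) func \<Rightarrow> ('o, 'm, 'r, 's) func"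
  (infixl "\<odot>" 70) where
  "G \<odot> F = \<lparr>fobj = (\<lambda>X. fobj G (fobj F X)), farr = (\<lambda>u. farr G (farr F u))\<rparr>"

text \<open>Equality of functors with domain \<open>C\<close>; values off the carriers of \<open>C\<close> are junk.\<close>

definition func_eq ::
  "('o, 'm) cat \<Rightarrow> ('o, 'm, 'p, 'q) func \<Rightarrow> ('o, 'm, 'p, 'q) func \<Rightarrow> bool" where
  "func_eq C F G \<longleftrightarrow>
     (\<forall>X\<in>Obj C. fobj F X = fobj G X) \<and> (\<forall>u\<in>Arr C. farr F u = farr G u)"

definition nat_trans ::
  "('o, 'm) cat \<Rightarrow> ('p, 'q) cat \<Rightarrow> ('o, 'm, 'p, 'q) func \<Rightarrow> ('o, 'm, 'p, 'q) func \<Rightarrow>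
    ('o \<Rightarrow> 'q) \<Rightarrow> bool" where
  "nat_trans C D F G \<tau> \<longleftrightarrow> is_functor C D F \<and> is_functor C D G \<and>
     (\<forall>X\<in>Obj C. \<tau> X \<in> hom D (fobj F X) (fobj G X)) \<and>
     (\<forall>u\<in>Arr C. \<tau> (tgt C u) \<cdot>\<^bsub>D\<^esub> farr F u = farr G u \<cdot>\<^bsub>D\<^esub> \<tau> (src C u))"

definition vcomp :: "('p, 'q) cat \<Rightarrow> ('o \<Rightarrow> 'q) \<Rightarrow> ('o \<Rightarrow> 'q) \<Rightarrow> 'o \<Rightarrow> 'q" where
  "vcomp D \<sigma> \<tau> = (\<lambda>X. \<sigma> X \<cdot>\<^bsub>D\<^esub> \<tau> X)"

text \<open>The whiskerings \<open>G \<tau>\<close> and \<open>\<tau> F\<close>.\<close>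

definition whisker_l :: "('p, 'q, 'r, 's) func \<Rightarrow> ('o \<Rightarrow> 'q) \<Rightarrow> 'o \<Rightarrow> 's" where
  "whisker_l G \<tau> = (\<lambda>X. farr G (\<tau> X))"

definition whisker_r :: "('p \<Rightarrow> 's) \<Rightarrow> ('o, 'm, 'p, 'q) func \<Rightarrow> 'o \<Rightarrow> 's" where
  "whisker_r \<tau> F = (\<lambda>X. \<tau> (fobj F X))"

definition nat_iso ::
  "('o, 'm) cat \<Rightarrow> ('p, 'q) cat \<Rightarrow> ('o, 'm, 'p, 'q) func \<Rightarrow> ('o, 'm, 'p, 'q) func \<Rightarrow>
    ('o \<Rightarrow> 'q) \<Rightarrow> bool" where
  "nat_iso C D F G \<tau> \<longleftrightarrow> nat_trans C D F G \<tau> \<and>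
     (\<exists>\<sigma>. nat_trans C D G F \<sigma> \<and>
        (\<forall>X\<in>Obj C. vcomp D \<sigma> \<tau> X = ident D (fobj F X)) \<and>
        (\<forall>X\<in>Obj C. vcomp D \<tau> \<sigma> X = ident D (fobj G X)))"

text \<open>\<open>L : C \<rightarrow> D\<close> is left adjoint to \<open>R : D \<rightarrow> C\<close> with unit \<open>\<eta>\<close> and counit \<open>\<epsilon>\<close>.\<close>

definition adjunction ::
  "('o, 'm) cat \<Rightarrow> ('p, 'q) cat \<Rightarrow> ('o, 'm, 'p, 'q) func \<Rightarrow> ('p, 'q, 'o, 'm) func \<Rightarrow>
    ('o \<Rightarrow> 'm) \<Rightarrow> ('p \<Rightarrow> 'q) \<Rightarrow> bool" where
  "adjunction C D L R \<eta> \<epsilon> \<longleftrightarrow> is_functor C D L \<and> is_functor D C R \<and>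
     nat_trans C C id_func (R \<odot> L) \<eta> \<and> nat_trans D D (L \<odot> R) id_func \<epsilon> \<and>
     (\<forall>X\<in>Obj C. vcomp D (whisker_r \<epsilon> L) (whisker_l L \<eta>) X = ident D (fobj L X)) \<and>
     (\<forall>Y\<in>Obj D. vcomp C (whisker_l R \<epsilon>) (whisker_r \<eta> R) Y = ident C (fobj R Y))"


section \<open>Bifibrations\<close>

definition cartesian ::
  "('o, 'm) cat \<Rightarrow> ('p, 'q) cat \<Rightarrow> ('o, 'm, 'p, 'q) func \<Rightarrow> 'm \<Rightarrow> bool" where
  "cartesian M A P k \<longleftrightarrow> k \<in> Arr M \<and>
     (\<forall>h\<in>Arr M. \<forall>w\<in>hom A (fobj P (src M h)) (fobj P (src M k)).
        tgt M h = tgt M k \<and> farr P h = farr P k \<cdot>\<^bsub>A\<^esub> w \<longrightarrow>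
        (\<exists>!v. v \<in> hom M (src M h) (src M k) \<and> farr P v = w \<and> k \<cdot>\<^bsub>M\<^esub> v = h))"

definition cocartesian ::
  "('o, 'm) cat \<Rightarrow> ('p, 'q) cat \<Rightarrow> ('o, 'm, 'p, 'q) func \<Rightarrow> 'm \<Rightarrow> bool" where
  "cocartesian M A P k \<longleftrightarrow> k \<in> Arr M \<and>
     (\<forall>h\<in>Arr M. \<forall>w\<in>hom A (fobj P (tgt M k)) (fobj P (tgt M h)).
        src M h = src M k \<and> farr P h = w \<cdot>\<^bsub>A\<^esub> farr P k \<longrightarrow>
        (\<exists>!v. v \<in> hom M (tgt M k) (tgt M h) \<and> farr P v = w \<and> v \<cdot>\<^bsub>M\<^esub> k = h))"

definition fibration ::
  "('o, 'm) cat \<Rightarrow> ('p, 'q) cat \<Rightarrow> ('o, 'm, 'p, 'q) func \<Rightarrow> bool" where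
  "fibration M A P \<longleftrightarrow> is_functor M A P \<and>
     (\<forall>f\<in>Arr A. \<forall>X\<in>Obj M. fobj P X = tgt A f \<longrightarrow>
        (\<exists>k. cartesian M A P k \<and> tgt M k = X \<and> farr P k = f))"

definition opfibration ::
  "('o, 'm) cat \<Rightarrow> ('p, 'q) cat \<Rightarrow> ('o, 'm, 'p, 'q) func \<Rightarrow> bool" where
  "opfibration M A P \<longleftrightarrow> is_functor M A P \<and>
     (\<forall>f\<in>Arr A. \<forall>X\<in>Obj M. fobj P X = src A f \<longrightarrow>
        (\<exists>k. cocartesian M A P k \<and> src M k = X \<and> farr P k = f))"

definition bifibration ::
  "('o, 'm) cat \<Rightarrow> ('p, 'q) cat \<Rightarrow> ('o, 'm, 'p, 'q) func \<Rightarrow> bool" where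
  "bifibration M A P \<longleftrightarrow> fibration M A P \<and> opfibration M A P"

definition fibre ::
  "('o, 'm) cat \<Rightarrow> ('p, 'q) cat \<Rightarrow> ('o, 'm, 'p, 'q) func \<Rightarrow> 'p \<Rightarrow> ('o, 'm) cat" where
  "fibre M A P B = M\<lparr>Obj := {X \<in> Obj M. fobj P X = B},
                     Arr := {u \<in> Arr M. farr P u = ident A B}\<rparr>"


section \<open>Inverse and direct images, base change\<close>

text \<open>A cleavage \<open>c\<close> chooses a Cartesian arrow \<open>c f X : f\<^sup>* X \<rightarrow> X\<close> over each \<open>f : B' \<rightarrow> B\<close>
  and \<open>X\<close> over \<open>B\<close>; it determines the functors \<open>f\<^sup>*\<close>.\<close>

definition cleavage ::
  "('o, 'm) cat \<Rightarrow> ('p, 'q) cat \<Rightarrow> ('o, 'm, 'p, 'q) func \<Rightarrow> ('q \<Rightarrow> 'o \<Rightarrow> 'm) \<Rightarrow> bool" where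
  "cleavage M A P c \<longleftrightarrow>
     (\<forall>f\<in>Arr A. \<forall>X\<in>Obj M. fobj P X = tgt A f \<longrightarrow>
        cartesian M A P (c f X) \<and> tgt M (c f X) = X \<and> farr P (c f X) = f)"

definition inverse_image ::
  "('o, 'm) cat \<Rightarrow> ('p, 'q) cat \<Rightarrow> ('o, 'm, 'p, 'q) func \<Rightarrow> ('q \<Rightarrow> 'o \<Rightarrow> 'm) \<Rightarrow> 'q \<Rightarrow>
    ('o, 'm, 'o, 'm) func" where
  "inverse_image M A P c f =
     \<lparr>fobj = (\<lambda>X. src M (c f X)),
      farr = (\<lambda>u. THE v. v \<in> hom (fibre M A P (src A f))
                                 (src M (c f (src M u))) (src M (c f (tgt M u))) \<and>
                         c f (tgt M u) \<cdot>\<^bsub>M\<^esub> v = u \<cdot>\<^bsub>M\<^esub> c f (src M u))\<rparr>"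

text \<open>Strict functoriality of \<open>f \<mapsto> f\<^sup>*\<close>: the canonical comparison isomorphisms
  \<open>f\<^sup>* g\<^sup>* X \<cong> (g f)\<^sup>* X\<close> and \<open>X \<cong> id\<^sup>* X\<close>, i.e. the vertical ones compatible with the chosen
  Cartesian arrows to \<open>X\<close>, are identities.  This says that the chosen arrows are closed under
  composition and contain the identities.  It implies equality of the functors \<open>(g f)\<^sup>*\<close> and
  \<open>f\<^sup>* g\<^sup>*\<close>, but is not implied by it.\<close>

definition split_cleavage ::
  "('o, 'm) cat \<Rightarrow> ('p, 'q) cat \<Rightarrow> ('o, 'm, 'p, 'q) func \<Rightarrow> ('q \<Rightarrow> 'o \<Rightarrow> 'm) \<Rightarrow> bool" where
  "split_cleavage M A P c \<longleftrightarrow> cleavage M A P c \<and>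
     (\<forall>X\<in>Obj M. c (ident A (fobj P X)) X = ident M X) \<and>
     (\<forall>f\<in>Arr A. \<forall>g\<in>Arr A. \<forall>X\<in>Obj M. tgt A f = src A g \<and> fobj P X = tgt A g \<longrightarrow>
        c (g \<cdot>\<^bsub>A\<^esub> f) X = c g X \<cdot>\<^bsub>M\<^esub> c f (src M (c g X)))"

text \<open>A choice of left adjoints \<open>f\<^sub>*\<close> of the \<open>f\<^sup>*\<close>, with units and counits, strictly functorial
  in \<open>f\<close>.  Such a choice amounts to a choice of co-Cartesian arrows: the composite
  \<open>X \<rightarrow> f\<^sup>* f\<^sub>* X \<rightarrow> f\<^sub>* X\<close> of the unit with the chosen Cartesian arrow is co-Cartesian over \<open>f\<close>.\<close>

definition direct_images ::
  "('o, 'm) cat \<Rightarrow> ('p, 'q) cat \<Rightarrow> ('o, 'm, 'p, 'q) func \<Rightarrow> ('q \<Rightarrow> 'o \<Rightarrow> 'm) \<Rightarrow>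
    ('q \<Rightarrow> ('o, 'm, 'o, 'm) func) \<Rightarrow> ('q \<Rightarrow> 'o \<Rightarrow> 'm) \<Rightarrow> ('q \<Rightarrow> 'o \<Rightarrow> 'm) \<Rightarrow> bool" where
  "direct_images M A P c d \<eta> \<epsilon> \<longleftrightarrow>
     (\<forall>f\<in>Arr A. adjunction (fibre M A P (src A f)) (fibre M A P (tgt A f))
                  (d f) (inverse_image M A P c f) (\<eta> f) (\<epsilon> f)) \<and>
     (\<forall>B\<in>Obj A. func_eq (fibre M A P B) (d (ident A B)) id_func) \<and>
     (\<forall>f\<in>Arr A. \<forall>g\<in>Arr A. tgt A f = src A g \<longrightarrow>
        func_eq (fibre M A P (src A f)) (d (g \<cdot>\<^bsub>A\<^esub> f)) (d g \<odot> d f))"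

text \<open>The base change morphism from \<open>(a\<^sub>2)\<^sub>* a\<^sub>1\<^sup>*\<close> to \<open>a\<^sup>* a\<^sub>*\<close>.  The middle functors
  \<open>(a\<^sub>2)\<^sub>* a\<^sub>1\<^sup>* a\<^sup>* a\<^sub>*\<close> and \<open>(a\<^sub>2)\<^sub>* a\<^sub>2\<^sup>* a\<^sup>* a\<^sub>*\<close> agree when \<open>a a\<^sub>1 = a a\<^sub>2\<close> and \<open>c\<close> is split.\<close>

definition base_change ::
  "('o, 'm) cat \<Rightarrow> ('p, 'q) cat \<Rightarrow> ('o, 'm, 'p, 'q) func \<Rightarrow> ('q \<Rightarrow> 'o \<Rightarrow> 'm) \<Rightarrow>
    ('q \<Rightarrow> ('o, 'm, 'o, 'm) func) \<Rightarrow> ('q \<Rightarrow> 'o \<Rightarrow> 'm) \<Rightarrow> ('q \<Rightarrow> 'o \<Rightarrow> 'm) \<Rightarrow>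
    'q \<Rightarrow> 'q \<Rightarrow> 'q \<Rightarrow> 'o \<Rightarrow> 'm" where
  "base_change M A P c d \<eta> \<epsilon> a a\<^sub>1 a\<^sub>2 =
     vcomp (fibre M A P (tgt A a\<^sub>2))
       (whisker_r (\<epsilon> a\<^sub>2) (inverse_image M A P c a \<odot> d a))
       (whisker_l (d a\<^sub>2 \<odot> inverse_image M A P c a\<^sub>1) (\<eta> a))"

end

theory Submission
  imports Defs
begin

text \<open>The composite \<open>X \<rightarrow> f\<^sup>* f\<^sub>* X \<rightarrow> f\<^sub>* X\<close> of the unit with the chosen Cartesian arrow is
  co-Cartesian over \<open>f\<close>.  Precomposing the component of \<open>\<chi>\<close> at \<open>X\<close> with this arrow for \<open>a\<^sub>2\<close> and
  \<open>a\<^sub>1\<^sup>* X\<close> gives, by the triangle identities, exactly the top arrow of the canonical Chevalley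
  square on \<open>X\<close>, whose vertical sides are the chosen Cartesian arrows and whose bottom is the
  co-Cartesian arrow \<open>X \<rightarrow> a\<^sub>* X\<close>.  So the top arrow is co-Cartesian iff \<open>\<chi>\<close> is invertible at \<open>X\<close>,
  and every Chevalley square is vertically isomorphic to a canonical one.\<close>

section \<open>Isomorphisms and componentwise invertibility of natural transformations\<close>

definition is_iso :: "('o, 'm) cat \<Rightarrow> 'm \<Rightarrow> bool" where
  "is_iso C u \<longleftrightarrow> u \<in> Arr C \<and> (\<exists>v \<in> hom C (tgt C u) (src C u).
     v \<cdot>\<^bsub>C\<^esub> u = ident C (src C u) \<and> u \<cdot>\<^bsub>C\<^esub> v = ident C (tgt C u))"

lemma is_isoI:
  assumes "u \<in> hom C X Y" "v \<in> hom C Y X" "v \<cdot>\<^bsub>C\<^esub> u = ident C X" "u \<cdot>\<^bsub>C\<^esub> v = ident C Y"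
  shows "is_iso C u"
  using assms unfolding is_iso_def hom_def by auto

lemma is_isoE:
  assumes "is_iso C u" "u \<in> hom C X Y"
  obtains v where "v \<in> hom C Y X" "v \<cdot>\<^bsub>C\<^esub> u = ident C X" "u \<cdot>\<^bsub>C\<^esub> v = ident C Y"
  using assms unfolding is_iso_def hom_def by auto

lemma is_functor_hom:
  assumes "is_functor C D F" "u \<in> hom C X Y"
  shows "farr F u \<in> hom D (fobj F X) (fobj F Y)"
  using assms unfolding is_functor_def hom_def by auto

lemma is_functor_comp:
  assumes F: "is_functor C D F" and G: "is_functor D E G"
  shows "is_functor C E (G \<odot> F)"
proof -
  have F_arr: "farr F u \<in> Arr D \<and> src D (farr F u) = fobj F (src C u) \<and>
      tgt D (farr F u) = fobj F (tgt C u)" if "u \<in> Arr C" for u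
    using F that unfolding is_functor_def hom_def by blast
  have "farr G (farr F u) \<in> hom E (fobj G (fobj F (src C u))) (fobj G (fobj F (tgt C u)))"
    if "u \<in> Arr C" for u
    using is_functor_hom[OF G, of "farr F u"] F_arr[OF that] unfolding hom_def by simp
  then show ?thesis
    using F G F_arr unfolding is_functor_def comp_func_def by simp
qed

lemma nat_transD:
  assumes "nat_trans C D F G \<tau>"
  shows "X \<in> Obj C \<Longrightarrow> \<tau> X \<in> hom D (fobj F X) (fobj G X)"
    and "u \<in> hom C X Y \<Longrightarrow> \<tau> Y \<cdot>\<^bsub>D\<^esub> farr F u = farr G u \<cdot>\<^bsub>D\<^esub> \<tau> X"
  using assms unfolding nat_trans_def hom_def by auto

text \<open>Inverses chosen component by component are automatically natural: conjugating the
  naturality square of \<open>\<tau>\<close> by them gives the square for \<open>\<sigma>\<close>.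
  Invertibility of \<open>\<chi>\<close> can therefore be tested one object at a time.\<close>

lemma nat_iso_iff:
  "nat_iso C D F G \<tau> \<longleftrightarrow> nat_trans C D F G \<tau> \<and> (\<forall>X\<in>Obj C. is_iso D (\<tau> X))"
proof (intro iffI conjI ballI; (elim conjE)?)
  assume "nat_iso C D F G \<tau>"
  then obtain \<sigma> where \<tau>: "nat_trans C D F G \<tau>" and \<sigma>: "nat_trans C D G F \<sigma>"
    and inv: "\<And>X. X \<in> Obj C \<Longrightarrow> \<sigma> X \<cdot>\<^bsub>D\<^esub> \<tau> X = ident D (fobj F X)"
      "\<And>X. X \<in> Obj C \<Longrightarrow> \<tau> X \<cdot>\<^bsub>D\<^esub> \<sigma> X = ident D (fobj G X)"
    unfolding nat_iso_def vcomp_def by blast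
  show "nat_trans C D F G \<tau>" by (rule \<tau>)
  show "is_iso D (\<tau> X)" if "X \<in> Obj C" for X
    using nat_transD(1)[OF \<tau> that] nat_transD(1)[OF \<sigma> that] inv[OF that] by (rule is_isoI)
next
  assume \<tau>: "nat_trans C D F G \<tau>" and iso: "\<forall>X\<in>Obj C. is_iso D (\<tau> X)"
  interpret C: category C using \<tau> unfolding nat_trans_def is_functor_def by auto
  interpret D: category D using \<tau> unfolding nat_trans_def is_functor_def by auto
  have F: "is_functor C D F" and G: "is_functor C D G"
    using \<tau> unfolding nat_trans_def by auto
  have "\<forall>X\<in>Obj C. \<exists>v. v \<in> hom D (fobj G X) (fobj F X) \<and>
      v \<cdot>\<^bsub>D\<^esub> \<tau> X = ident D (fobj F X) \<and> \<tau> X \<cdot>\<^bsub>D\<^esub> v = ident D (fobj G X)"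
    using iso nat_transD(1)[OF \<tau>] by (meson is_isoE)
  then obtain \<sigma> where \<sigma>: "X \<in> Obj C \<Longrightarrow> \<sigma> X \<in> hom D (fobj G X) (fobj F X)"
      "X \<in> Obj C \<Longrightarrow> \<sigma> X \<cdot>\<^bsub>D\<^esub> \<tau> X = ident D (fobj F X)"
      "X \<in> Obj C \<Longrightarrow> \<tau> X \<cdot>\<^bsub>D\<^esub> \<sigma> X = ident D (fobj G X)" for X
    by metis
  have "\<sigma> (tgt C u) \<cdot>\<^bsub>D\<^esub> farr G u = farr F u \<cdot>\<^bsub>D\<^esub> \<sigma> (src C u)" if u: "u \<in> Arr C" for u
  proof -
    define X Y where XY: "X = src C u" "Y = tgt C u"
    have X: "X \<in> Obj C" and Y: "Y \<in> Obj C" and uh: "u \<in> hom C X Y"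
      using u C.src_obj C.tgt_obj unfolding XY hom_def by auto
    note Fu = is_functor_hom[OF F uh] and Gu = is_functor_hom[OF G uh]
      and \<tau>X = nat_transD(1)[OF \<tau> X] and \<tau>Y = nat_transD(1)[OF \<tau> Y]
    have "\<sigma> Y \<cdot>\<^bsub>D\<^esub> farr G u = \<sigma> Y \<cdot>\<^bsub>D\<^esub> (farr G u \<cdot>\<^bsub>D\<^esub> (\<tau> X \<cdot>\<^bsub>D\<^esub> \<sigma> X))"
      using \<sigma>(3)[OF X] D.ident_right[OF Gu] by simp
    also have "\<dots> = \<sigma> Y \<cdot>\<^bsub>D\<^esub> ((\<tau> Y \<cdot>\<^bsub>D\<^esub> farr F u) \<cdot>\<^bsub>D\<^esub> \<sigma> X)"
      using D.cmp_assoc[OF \<sigma>(1)[OF X] \<tau>X Gu] nat_transD(2)[OF \<tau> uh] by simp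
    also have "\<dots> = (\<sigma> Y \<cdot>\<^bsub>D\<^esub> \<tau> Y) \<cdot>\<^bsub>D\<^esub> (farr F u \<cdot>\<^bsub>D\<^esub> \<sigma> X)"
      using D.cmp_assoc[OF \<sigma>(1)[OF X] Fu \<tau>Y]
        D.cmp_assoc[OF D.cmp_hom[OF \<sigma>(1)[OF X] Fu] \<tau>Y \<sigma>(1)[OF Y]] by simp
    also have "\<dots> = farr F u \<cdot>\<^bsub>D\<^esub> \<sigma> X"
      using \<sigma>(2)[OF Y] D.ident_left[OF D.cmp_hom[OF \<sigma>(1)[OF X] Fu]] by simp
    finally show ?thesis unfolding XY .
  qed
  then show "nat_iso C D F G \<tau>"
    unfolding nat_iso_def vcomp_def using \<tau> \<sigma> F G
    by (intro conjI exI[of _ \<sigma>]) (auto simp: nat_trans_def)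
qed

section \<open>Arrows over a fixed base arrow, and lifting along Cartesian and co-Cartesian
  arrows\<close>

locale functor_over =
  fixes M :: "('o, 'm) cat" (structure) and A :: "('p, 'q) cat" and P :: "('o, 'm, 'p, 'q) func"
  assumes P: "is_functor M A P"
begin

sublocale M: category M using P unfolding is_functor_def by simp
sublocale A: category A using P unfolding is_functor_def by simp

text \<open>Recording the base arrow together with the endpoints makes the arrows of a fibre the
  case \<open>hom_over (ident A B)\<close>, so vertical and non-vertical arrows compose by the same
  rules.\<close>

definition hom_over :: "'q \<Rightarrow> 'o \<Rightarrow> 'o \<Rightarrow> 'm set" where
  "hom_over f X Y = {u \<in> hom M X Y. farr P u = f}"

lemma hom_overD:
  assumes "u \<in> hom_over f X Y"
  shows "u \<in> hom M X Y" "farr P u = f" "u \<in> Arr M" "src M u = X" "tgt M u = Y"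
    "X \<in> Obj M" "Y \<in> Obj M" "f \<in> hom A (fobj P X) (fobj P Y)"
proof -
  show u: "u \<in> hom M X Y" "farr P u = f" "u \<in> Arr M" "src M u = X" "tgt M u = Y"
    using assms unfolding hom_over_def hom_def by auto
  show "X \<in> Obj M" "Y \<in> Obj M" using M.src_obj[OF u(3)] M.tgt_obj[OF u(3)] u(4,5) by auto
  show "f \<in> hom A (fobj P X) (fobj P Y)" using is_functor_hom[OF P u(1)] u(2) by simp
qed

lemma fibre_simps [simp]:
  "Obj (fibre M A P B) = {X \<in> Obj M. fobj P X = B}"
  "src (fibre M A P B) = src M" "tgt (fibre M A P B) = tgt M"
  "ident (fibre M A P B) = ident M" "cmp (fibre M A P B) = cmp M"
  by (simp_all add: fibre_def)

lemma hom_fibre [simp]: "hom (fibre M A P B) X Y = hom_over (ident A B) X Y"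
  by (auto simp: hom_def hom_over_def fibre_def)

lemma over_comp:
  assumes "u \<in> hom_over f X Y" "v \<in> hom_over g Y Z"
  shows "v \<cdot> u \<in> hom_over (g \<cdot>\<^bsub>A\<^esub> f) X Z"
  using hom_overD[OF assms(1)] hom_overD[OF assms(2)] M.cmp_hom[of u X Y v Z] P
  unfolding hom_over_def is_functor_def by simp

text \<open>Absorbing the identity into \<open>f\<close> at once keeps base identities out of the
  later diagram chases, where vertical arrows are composed onto others all the time.\<close>

lemma over_comp_left:
  assumes "u \<in> hom_over f X Y" "v \<in> hom_over (ident A B) Y Z" "f \<in> hom A B' B"
  shows "v \<cdot> u \<in> hom_over f X Z"
  using over_comp[OF assms(1,2)] A.ident_left[OF assms(3)] by simp

lemma over_comp_right:
  assumes "u \<in> hom_over (ident A B) X Y" "v \<in> hom_over f Y Z" "f \<in> hom A B B'"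
  shows "v \<cdot> u \<in> hom_over f X Z"
  using over_comp[OF assms(1,2)] A.ident_right[OF assms(3)] by simp

lemma ident_over: "X \<in> Obj M \<Longrightarrow> fobj P X = B \<Longrightarrow> ident M X \<in> hom_over (ident A B) X X"
  using M.ident_hom P unfolding hom_over_def is_functor_def by auto

lemma assoc:
  assumes "u \<in> hom_over f W X" "v \<in> hom_over g X Y" "w \<in> hom_over h Y Z"
  shows "(w \<cdot> v) \<cdot> u = w \<cdot> (v \<cdot> u)"
  using assms hom_overD(1) M.cmp_assoc by metis

lemma unit_left: "u \<in> hom_over f X Y \<Longrightarrow> ident M Y \<cdot> u = u"
  using hom_overD(1) M.ident_left by metis

lemma unit_right: "u \<in> hom_over f X Y \<Longrightarrow> u \<cdot> ident M X = u"
  using hom_overD(1) M.ident_right by metis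

lemma over_obj:
  assumes "u \<in> hom_over f X Y" "f \<in> hom A B B'"
  shows "fobj P X = B" "fobj P Y = B'"
  using hom_overD(8)[OF assms(1)] assms(2) unfolding hom_def by auto

lemma cartesian_lift:
  assumes "cartesian M A P k" "k \<in> hom_over g Y Z" "h \<in> hom_over (g \<cdot>\<^bsub>A\<^esub> w) X Z"
    "w \<in> hom A (fobj P X) (fobj P Y)"
  shows "\<exists>!v. v \<in> hom_over w X Y \<and> k \<cdot> v = h"
  using assms(1)[unfolded cartesian_def, THEN conjunct2, rule_format, of h w] assms(4)
    hom_overD[OF assms(2)] hom_overD[OF assms(3)]
  by (simp add: hom_over_def conj_assoc)

text \<open>Both arrows are lifts of the same composite \<open>k \<cdot> v\<close> along the same
  \<open>w\<close>, so uniqueness of lifts identifies them.\<close>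

lemma cartesian_cancel:
  assumes "cartesian M A P k" "k \<in> hom_over g Y Z"
    "v \<in> hom_over w X Y" "v' \<in> hom_over w X Y" "k \<cdot> v = k \<cdot> v'"
  shows "v = v'"
  using cartesian_lift[OF assms(1,2) over_comp[OF assms(3,2)] hom_overD(8)[OF assms(3)]]
    assms(3-5) by metis

lemma cartesian_lift_vertical:
  assumes "cartesian M A P k" "k \<in> hom_over g Y Z" "h \<in> hom_over g X Z" "g \<in> hom A B B'"
  obtains v where "v \<in> hom_over (ident A B) X Y" "k \<cdot> v = h"
proof -
  have "B \<in> Obj A" using A.src_obj assms(4) unfolding hom_def by auto
  then have "ident A B \<in> hom A (fobj P X) (fobj P Y)"
    using A.ident_hom over_obj(1)[OF assms(2,4)] over_obj(1)[OF assms(3,4)] by simp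
  then show ?thesis
    using cartesian_lift[OF assms(1,2), of h "ident A B" X] assms(3) A.ident_right[OF assms(4)] that
    by auto
qed

lemma cocartesian_lift:
  assumes "cocartesian M A P k" "k \<in> hom_over f X Y" "h \<in> hom_over (w \<cdot>\<^bsub>A\<^esub> f) X Z"
    "w \<in> hom A (fobj P Y) (fobj P Z)"
  shows "\<exists>!v. v \<in> hom_over w Y Z \<and> v \<cdot> k = h"
  using assms(1)[unfolded cocartesian_def, THEN conjunct2, rule_format, of h w] assms(4)
    hom_overD[OF assms(2)] hom_overD[OF assms(3)]
  by (simp add: hom_over_def conj_assoc)

lemma cocartesian_cancel:
  assumes "cocartesian M A P k" "k \<in> hom_over f X Y"
    "v \<in> hom_over w Y Z" "v' \<in> hom_over w Y Z" "v \<cdot> k = v' \<cdot> k"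
  shows "v = v'"
  using cocartesian_lift[OF assms(1,2) over_comp[OF assms(2,3)] hom_overD(8)[OF assms(3)]]
    assms(3-5) by metis

lemma cocartesian_lift_vertical:
  assumes "cocartesian M A P k" "k \<in> hom_over f X Y" "h \<in> hom_over f X Z" "f \<in> hom A B B'"
  obtains v where "v \<in> hom_over (ident A B') Y Z" "v \<cdot> k = h"
proof -
  have "B' \<in> Obj A" using A.tgt_obj assms(4) unfolding hom_def by auto
  then have "ident A B' \<in> hom A (fobj P Y) (fobj P Z)"
    using A.ident_hom over_obj(2)[OF assms(2,4)] over_obj(2)[OF assms(3,4)] by simp
  then show ?thesis
    using cocartesian_lift[OF assms(1,2), of h "ident A B'" Z] assms(3) A.ident_left[OF assms(4)] that
    by auto
qed

lemma cartesianI: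
  assumes "k \<in> hom_over g Y Z"
    and "\<And>X h w. h \<in> hom_over (g \<cdot>\<^bsub>A\<^esub> w) X Z \<Longrightarrow> w \<in> hom A (fobj P X) (fobj P Y) \<Longrightarrow>
      \<exists>!v. v \<in> hom_over w X Y \<and> k \<cdot> v = h"
  shows "cartesian M A P k"
  unfolding cartesian_def
proof (intro conjI ballI impI; (elim conjE)?)
  note k = hom_overD[OF assms(1)]
  show "k \<in> Arr M" by (rule k)
  fix h w assume "h \<in> Arr M" "w \<in> hom A (fobj P (src M h)) (fobj P (src M k))"
    "tgt M h = tgt M k" "farr P h = farr P k \<cdot>\<^bsub>A\<^esub> w"
  then show "\<exists>!v. v \<in> hom M (src M h) (src M k) \<and> farr P v = w \<and> k \<cdot> v = h"
    using assms(2)[of h w "src M h"] k by (simp add: hom_over_def hom_def conj_assoc)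
qed

lemma cocartesianI:
  assumes "k \<in> hom_over f X Y"
    and "\<And>Z h w. h \<in> hom_over (w \<cdot>\<^bsub>A\<^esub> f) X Z \<Longrightarrow> w \<in> hom A (fobj P Y) (fobj P Z) \<Longrightarrow>
      \<exists>!v. v \<in> hom_over w Y Z \<and> v \<cdot> k = h"
  shows "cocartesian M A P k"
  unfolding cocartesian_def
proof (intro conjI ballI impI; (elim conjE)?)
  note k = hom_overD[OF assms(1)]
  show "k \<in> Arr M" by (rule k)
  fix h w assume "h \<in> Arr M" "w \<in> hom A (fobj P (tgt M k)) (fobj P (tgt M h))"
    "src M h = src M k" "farr P h = w \<cdot>\<^bsub>A\<^esub> farr P k"
  then show "\<exists>!v. v \<in> hom M (tgt M k) (tgt M h) \<and> farr P v = w \<and> v \<cdot> k = h"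
    using assms(2)[of h w "tgt M h"] k by (simp add: hom_over_def hom_def conj_assoc)
qed

section \<open>Vertical isomorphisms and their effect on Cartesian and co-Cartesian arrows\<close>

lemma fibre_isoE:
  assumes "is_iso (fibre M A P B) u" "u \<in> hom_over (ident A B) X Y"
  obtains v where "v \<in> hom_over (ident A B) Y X" "v \<cdot> u = ident M X" "u \<cdot> v = ident M Y"
  using is_isoE[OF assms(1), of X Y] assms(2) by auto

lemma fibre_isoI:
  assumes "u \<in> hom_over (ident A B) X Y" "v \<in> hom_over (ident A B) Y X"
    "v \<cdot> u = ident M X" "u \<cdot> v = ident M Y"
  shows "is_iso (fibre M A P B) u"
  using is_isoI[of u "fibre M A P B" X Y v] assms by auto

text \<open>Lifting \<open>k\<close> through the Cartesian arrow \<open>k \<cdot> v\<close> produces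
  the candidate inverse \<open>w\<close>. Cancelling \<open>k\<close> settles
  \<open>v \<cdot> w\<close>, and cancelling \<open>k \<cdot> v\<close> settles
  \<open>w \<cdot> v\<close>.\<close>

lemma cartesian_comparison_iso:
  assumes "cartesian M A P k" "k \<in> hom_over g Y Z" "g \<in> hom A B B'"
    and "v \<in> hom_over (ident A B) Y' Y" and "cartesian M A P (k \<cdot> v)"
  shows "is_iso (fibre M A P B) v"
proof -
  note kv = over_comp_right[OF assms(4,2,3)]
  obtain w where w: "w \<in> hom_over (ident A B) Y Y'" "(k \<cdot> v) \<cdot> w = k"
    using cartesian_lift_vertical[OF assms(5) kv assms(2,3)] .
  have B: "ident A B \<in> hom A B B"
    using A.ident_hom A.src_obj assms(3) unfolding hom_def by auto
  have Y: "Y \<in> Obj M" "fobj P Y = B" and Y': "Y' \<in> Obj M" "fobj P Y' = B"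
    using hom_overD(6,7)[OF w(1)] over_obj[OF w(1) B] by auto
  have vw: "v \<cdot> w = ident M Y"
    using cartesian_cancel[OF assms(1,2) over_comp_left[OF w(1) assms(4) B] ident_over[OF Y]]
      w(2) assoc[OF w(1) assms(4,2)] unit_right[OF assms(2)] by simp
  have "(k \<cdot> v) \<cdot> (w \<cdot> v) = (k \<cdot> v) \<cdot> ident M Y'"
    using assoc[OF assms(4) w(1) kv] w(2) unit_right[OF kv] by simp
  then have "w \<cdot> v = ident M Y'"
    using cartesian_cancel[OF assms(5) kv over_comp_left[OF assms(4) w(1) B] ident_over[OF Y']]
    by simp
  then show ?thesis using fibre_isoI[OF assms(4) w(1)] vw by simp
qed

text \<open>Dual argument: the candidate inverse \<open>w\<close> is the extension of
  \<open>k\<close> along the co-Cartesian arrow \<open>v \<cdot> k\<close>.\<close>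

lemma cocartesian_comparison_iso:
  assumes "cocartesian M A P k" "k \<in> hom_over f X Y" "f \<in> hom A B' B"
    and "v \<in> hom_over (ident A B) Y Y'" and "cocartesian M A P (v \<cdot> k)"
  shows "is_iso (fibre M A P B) v"
proof -
  note vk = over_comp_left[OF assms(2,4,3)]
  obtain w where w: "w \<in> hom_over (ident A B) Y' Y" "w \<cdot> (v \<cdot> k) = k"
    using cocartesian_lift_vertical[OF assms(5) vk assms(2,3)] .
  have B: "ident A B \<in> hom A B B"
    using A.ident_hom A.tgt_obj assms(3) unfolding hom_def by auto
  have Y: "Y \<in> Obj M" "fobj P Y = B" and Y': "Y' \<in> Obj M" "fobj P Y' = B"
    using hom_overD(6,7)[OF w(1)] over_obj[OF w(1) B] by auto
  have wv: "w \<cdot> v = ident M Y"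
    using cocartesian_cancel[OF assms(1,2) over_comp_left[OF assms(4) w(1) B] ident_over[OF Y]]
      w(2) assoc[OF assms(2,4) w(1)] unit_left[OF assms(2)] by simp
  have "(v \<cdot> w) \<cdot> (v \<cdot> k) = ident M Y' \<cdot> (v \<cdot> k)"
    using assoc[OF vk w(1) assms(4)] w(2) unit_left[OF vk] by simp
  then have "v \<cdot> w = ident M Y'"
    using cocartesian_cancel[OF assms(5) vk over_comp_left[OF w(1) assms(4) B] ident_over[OF Y']]
    by simp
  then show ?thesis using fibre_isoI[OF assms(4) w(1)] wv by simp
qed

text \<open>With \<open>s\<close> inverse to \<open>t\<close>, the equations
  \<open>(t \<cdot> k) \<cdot> v = h\<close> and \<open>k \<cdot> v = s \<cdot> h\<close> have the
  same solutions \<open>v\<close>, so the universal property of \<open>k\<close> applies.\<close>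

lemma cartesian_iso_comp:
  assumes k: "cartesian M A P k" "k \<in> hom_over g Y Z" and g: "g \<in> hom A B' B"
    and t: "is_iso (fibre M A P B) t" "t \<in> hom_over (ident A B) Z Z'"
  shows "cartesian M A P (t \<cdot> k)"
proof -
  obtain s where s: "s \<in> hom_over (ident A B) Z' Z" "s \<cdot> t = ident M Z" "t \<cdot> s = ident M Z'"
    using fibre_isoE[OF t] .
  show ?thesis
  proof (rule cartesianI[OF over_comp_left[OF k(2) t(2) g]])
    fix X h w assume h: "h \<in> hom_over (g \<cdot>\<^bsub>A\<^esub> w) X Z'" and w: "w \<in> hom A (fobj P X) (fobj P Y)"
    have gw: "g \<cdot>\<^bsub>A\<^esub> w \<in> hom A (fobj P X) B"
      using A.cmp_hom[OF w] g over_obj[OF k(2) g] by simp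
    have "(t \<cdot> k) \<cdot> v = h \<longleftrightarrow> k \<cdot> v = s \<cdot> h" if v: "v \<in> hom_over w X Y" for v
    proof
      assume "(t \<cdot> k) \<cdot> v = h"
      then have "h = t \<cdot> (k \<cdot> v)" using assoc[OF v k(2) t(2)] by simp
      then show "k \<cdot> v = s \<cdot> h"
        using assoc[OF over_comp[OF v k(2)] t(2) s(1)] s(2) unit_left[OF over_comp[OF v k(2)]] by simp
    next
      assume "k \<cdot> v = s \<cdot> h"
      then show "(t \<cdot> k) \<cdot> v = h"
        using assoc[OF v k(2) t(2)] assoc[OF h s(1) t(2)] s(3) unit_left[OF h] by simp
    qed
    then show "\<exists>!v. v \<in> hom_over w X Y \<and> (t \<cdot> k) \<cdot> v = h"
      using cartesian_lift[OF k over_comp_left[OF h s(1) gw] w] by metis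
  qed
qed

text \<open>Here \<open>t\<close> changes only the source of \<open>k\<close>, so the unknown arrow
  out of \<open>Y\<close> is the same for \<open>k\<close> and for \<open>k \<cdot> t\<close>; only
  the right-hand side changes, from \<open>h\<close> to \<open>h \<cdot> s\<close>.\<close>

lemma cocartesian_comp_iso:
  assumes k: "cocartesian M A P k" "k \<in> hom_over f X Y" and f: "f \<in> hom A B B'"
    and t: "is_iso (fibre M A P B) t" "t \<in> hom_over (ident A B) X' X"
  shows "cocartesian M A P (k \<cdot> t)"
proof -
  obtain s where s: "s \<in> hom_over (ident A B) X X'" "s \<cdot> t = ident M X'" "t \<cdot> s = ident M X"
    using fibre_isoE[OF t] .
  show ?thesis
  proof (rule cocartesianI[OF over_comp_right[OF t(2) k(2) f]])
    fix Z h w assume h: "h \<in> hom_over (w \<cdot>\<^bsub>A\<^esub> f) X' Z" and w: "w \<in> hom A (fobj P Y) (fobj P Z)"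
    have fw: "w \<cdot>\<^bsub>A\<^esub> f \<in> hom A B (fobj P Z)"
      using A.cmp_hom[OF _ w] f over_obj[OF k(2) f] by simp
    have "v \<cdot> (k \<cdot> t) = h \<longleftrightarrow> v \<cdot> k = h \<cdot> s" if v: "v \<in> hom_over w Y Z" for v
    proof
      assume "v \<cdot> (k \<cdot> t) = h"
      then have "h = (v \<cdot> k) \<cdot> t" using assoc[OF t(2) k(2) v] by simp
      then show "v \<cdot> k = h \<cdot> s"
        using assoc[OF s(1) t(2) over_comp[OF k(2) v]] s(3) unit_right[OF over_comp[OF k(2) v]] by simp
    next
      assume "v \<cdot> k = h \<cdot> s"
      then show "v \<cdot> (k \<cdot> t) = h"
        using assoc[OF t(2) k(2) v] assoc[OF t(2) s(1) h] s(2) unit_right[OF h] by simp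
    qed
    then show "\<exists>!v. v \<in> hom_over w Y Z \<and> v \<cdot> (k \<cdot> t) = h"
      using cocartesian_lift[OF k over_comp_right[OF s(1) h fw] w] by metis
  qed
qed

text \<open>Now \<open>t\<close> moves the object out of which the unknown arrow starts, so the two
  extension problems do not share their solutions. Solutions for \<open>t \<cdot> k\<close>
  correspond to solutions for \<open>k\<close> by composing with \<open>t\<close>, and back by
  composing with \<open>s\<close>.\<close>

lemma cocartesian_iso_comp:
  assumes k: "cocartesian M A P k" "k \<in> hom_over f X Y" and f: "f \<in> hom A B' B"
    and t: "is_iso (fibre M A P B) t" "t \<in> hom_over (ident A B) Y Y'"
  shows "cocartesian M A P (t \<cdot> k)"
proof -
  obtain s where s: "s \<in> hom_over (ident A B) Y' Y" "s \<cdot> t = ident M Y" "t \<cdot> s = ident M Y'"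
    using fibre_isoE[OF t] .
  have Y: "fobj P Y = B" using over_obj[OF k(2) f] by simp
  have B: "ident A B \<in> hom A B B"
    using A.ident_hom A.tgt_obj f unfolding hom_def by auto
  have Y': "fobj P Y' = B" using over_obj[OF t(2) B] by simp
  show ?thesis
  proof (rule cocartesianI[OF over_comp_left[OF k(2) t(2) f]])
    fix Z h w assume h: "h \<in> hom_over (w \<cdot>\<^bsub>A\<^esub> f) X Z" and w: "w \<in> hom A (fobj P Y') (fobj P Z)"
    have w': "w \<in> hom A B (fobj P Z)" "w \<in> hom A (fobj P Y) (fobj P Z)" using w Y Y' by simp_all
    obtain u where u: "u \<in> hom_over w Y Z" "u \<cdot> k = h"
      using cocartesian_lift[OF k h w'(2)] by blast
    note us = over_comp_right[OF s(1) u(1) w'(1)]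
    have eq: "(u \<cdot> s) \<cdot> (t \<cdot> k) = h"
      using assoc[OF k(2) t(2) us] assoc[OF t(2) s(1) u(1)] s(2) unit_right[OF u(1)] u(2) by simp
    moreover have "v = u \<cdot> s" if v: "v \<in> hom_over w Y' Z" "v \<cdot> (t \<cdot> k) = h" for v
    proof -
      have "v \<cdot> t = u"
        using cocartesian_cancel[OF k over_comp_right[OF t(2) v(1) w'(1)] u(1)]
          assoc[OF k(2) t(2) v(1)] v(2) u(2) by simp
      then show ?thesis using assoc[OF s(1) t(2) v(1)] s(3) unit_right[OF v(1)] by simp
    qed
    ultimately show "\<exists>!v. v \<in> hom_over w Y' Z \<and> v \<cdot> (t \<cdot> k) = h" using us by blast
  qed
qed

end


section \<open>Inverse and direct images, and the co-Cartesian arrows given by the units\<close>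

locale bifibred = functor_over M A P
  for M :: "('o, 'm) cat" (structure) and A :: "('p, 'q) cat" and P :: "('o, 'm, 'p, 'q) func" +
  fixes c :: "'q \<Rightarrow> 'o \<Rightarrow> 'm" and d :: "'q \<Rightarrow> ('o, 'm, 'o, 'm) func"
    and \<eta> \<epsilon> :: "'q \<Rightarrow> 'o \<Rightarrow> 'm"
  assumes split: "split_cleavage M A P c"
    and direct: "direct_images M A P c d \<eta> \<epsilon>"
begin

abbreviation pull :: "'q \<Rightarrow> ('o, 'm, 'o, 'm) func" where
  "pull \<equiv> inverse_image M A P c"

lemma cleavage_arrow:
  assumes "f \<in> hom A B B'" "X \<in> Obj M" "fobj P X = B'"
  shows "cartesian M A P (c f X)" "c f X \<in> hom_over f (fobj (pull f) X) X"
  using split assms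
  unfolding split_cleavage_def cleavage_def hom_over_def hom_def inverse_image_def cartesian_def
  by auto

lemma cleavage_comp:
  assumes "f \<in> hom A B B'" "g \<in> hom A B' B''" "X \<in> Obj M" "fobj P X = B''"
  shows "c (g \<cdot>\<^bsub>A\<^esub> f) X = c g X \<cdot> c f (fobj (pull g) X)"
  using split assms unfolding split_cleavage_def hom_def inverse_image_def by auto

lemma adj:
  assumes "f \<in> hom A B B'"
  shows "is_functor (fibre M A P B) (fibre M A P B') (d f)"
    and "is_functor (fibre M A P B') (fibre M A P B) (pull f)"
    and "nat_trans (fibre M A P B) (fibre M A P B) id_func (pull f \<odot> d f) (\<eta> f)"
    and "nat_trans (fibre M A P B') (fibre M A P B') (d f \<odot> pull f) id_func (\<epsilon> f)"
  using direct assms unfolding direct_images_def adjunction_def hom_def by auto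

lemma triangle:
  assumes "f \<in> hom A B B'"
  shows "X \<in> Obj M \<Longrightarrow> fobj P X = B \<Longrightarrow>
      \<epsilon> f (fobj (d f) X) \<cdot> farr (d f) (\<eta> f X) = ident M (fobj (d f) X)"
    and "Y \<in> Obj M \<Longrightarrow> fobj P Y = B' \<Longrightarrow>
      farr (pull f) (\<epsilon> f Y) \<cdot> \<eta> f (fobj (pull f) Y) = ident M (fobj (pull f) Y)"
  using direct assms
  unfolding direct_images_def adjunction_def hom_def vcomp_def whisker_l_def whisker_r_def by auto

lemma direct_obj:
  assumes "f \<in> hom A B B'" "X \<in> Obj M" "fobj P X = B"
  shows "fobj (d f) X \<in> Obj M" "fobj P (fobj (d f) X) = B'"
  using adj(1)[OF assms(1)] assms(2,3) unfolding is_functor_def by auto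

lemma pull_obj:
  assumes "f \<in> hom A B B'" "X \<in> Obj M" "fobj P X = B'"
  shows "fobj (pull f) X \<in> Obj M" "fobj P (fobj (pull f) X) = B"
  using adj(2)[OF assms(1)] assms(2,3) unfolding is_functor_def by auto

lemma direct_over:
  assumes "f \<in> hom A B B'" "u \<in> hom_over (ident A B) X Y"
  shows "farr (d f) u \<in> hom_over (ident A B') (fobj (d f) X) (fobj (d f) Y)"
  using is_functor_hom[OF adj(1)[OF assms(1)], of u X Y] assms(2) by simp

lemma pull_over:
  assumes "f \<in> hom A B B'" "u \<in> hom_over (ident A B') X Y"
  shows "farr (pull f) u \<in> hom_over (ident A B) (fobj (pull f) X) (fobj (pull f) Y)"
  using is_functor_hom[OF adj(2)[OF assms(1)], of u X Y] assms(2) by simp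

lemma unit_over:
  assumes "f \<in> hom A B B'" "X \<in> Obj M" "fobj P X = B"
  shows "\<eta> f X \<in> hom_over (ident A B) X (fobj (pull f) (fobj (d f) X))"
  using nat_transD(1)[OF adj(3)[OF assms(1)], of X] assms(2,3)
  by (simp add: id_func_def comp_func_def)

lemma counit_over:
  assumes "f \<in> hom A B B'" "X \<in> Obj M" "fobj P X = B'"
  shows "\<epsilon> f X \<in> hom_over (ident A B') (fobj (d f) (fobj (pull f) X)) X"
  using nat_transD(1)[OF adj(4)[OF assms(1)], of X] assms(2,3)
  by (simp add: id_func_def comp_func_def)

lemma unit_natural:
  assumes "f \<in> hom A B B'" "u \<in> hom_over (ident A B) X Y"
  shows "\<eta> f Y \<cdot> u = farr (pull f) (farr (d f) u) \<cdot> \<eta> f X"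
  using nat_transD(2)[OF adj(3)[OF assms(1)], of u X Y] assms(2)
  by (simp add: id_func_def comp_func_def)

lemma counit_natural:
  assumes "f \<in> hom A B B'" "u \<in> hom_over (ident A B') X Y"
  shows "\<epsilon> f Y \<cdot> farr (d f) (farr (pull f) u) = u \<cdot> \<epsilon> f X"
  using nat_transD(2)[OF adj(4)[OF assms(1)], of u X Y] assms(2)
  by (simp add: id_func_def comp_func_def)

lemma vertical_obj:
  assumes "u \<in> hom_over (ident A B) X Y" "B \<in> Obj A"
  shows "X \<in> Obj M" "Y \<in> Obj M" "fobj P X = B" "fobj P Y = B"
  using hom_overD(6,7)[OF assms(1)] over_obj[OF assms(1) A.ident_hom[OF assms(2)]] by auto

lemma hom_obj: "f \<in> hom A B B' \<Longrightarrow> B \<in> Obj A" "f \<in> hom A B B' \<Longrightarrow> B' \<in> Obj A"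
  using A.src_obj A.tgt_obj unfolding hom_def by auto

text \<open>The inverse image of an arrow is a definite description. A vertical lift along
  \<open>c f Y\<close> satisfies it and cancellation makes that lift the only one, so the
  description has a value and its square commutes.\<close>

lemma pull_square:
  assumes f: "f \<in> hom A B B'" and u: "u \<in> hom_over (ident A B') X Y"
  shows "c f Y \<cdot> farr (pull f) u = u \<cdot> c f X"
proof -
  note uo = vertical_obj[OF u hom_obj(2)[OF f]]
  note cX = cleavage_arrow[OF f uo(1,3)] and cY = cleavage_arrow[OF f uo(2,4)]
  note h = over_comp_left[OF cX(2) u f]
  obtain v where v: "v \<in> hom_over (ident A B) (fobj (pull f) X) (fobj (pull f) Y)"
      "c f Y \<cdot> v = u \<cdot> c f X"
    using cartesian_lift_vertical[OF cY h f] .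
  have "farr (pull f) u = (THE v. v \<in> hom_over (ident A B) (fobj (pull f) X) (fobj (pull f) Y) \<and>
      c f Y \<cdot> v = u \<cdot> c f X)"
    using hom_overD(4,5)[OF u] f by (simp add: inverse_image_def hom_def[of A])
  also have "\<dots> = v"
    using v cartesian_cancel[OF cY] by (intro the_equality) auto
  finally show ?thesis using v(2) by simp
qed

definition direct_arrow :: "'q \<Rightarrow> 'o \<Rightarrow> 'm" where
  "direct_arrow f X = c f (fobj (d f) X) \<cdot> \<eta> f X"

lemma direct_arrow_over:
  assumes "f \<in> hom A B B'" "X \<in> Obj M" "fobj P X = B"
  shows "direct_arrow f X \<in> hom_over f X (fobj (d f) X)"
  unfolding direct_arrow_def
  using over_comp_right[OF unit_over[OF assms] cleavage_arrow(2)[OF assms(1) direct_obj[OF assms]] assms(1)] .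

text \<open>Pastes two squares: naturality of the unit, and the square of chosen Cartesian arrows
  over the direct image of \<open>u\<close>.\<close>

lemma direct_arrow_natural:
  assumes f: "f \<in> hom A B B'" and u: "u \<in> hom_over (ident A B) X Y"
  shows "farr (d f) u \<cdot> direct_arrow f X = direct_arrow f Y \<cdot> u"
proof -
  note uo = vertical_obj[OF u hom_obj(1)[OF f]]
  note X = f uo(1,3) and Y = f uo(2,4)
  note fu = direct_over[OF f u]
  note cX = cleavage_arrow(2)[OF f direct_obj[OF X]] and cY = cleavage_arrow(2)[OF f direct_obj[OF Y]]
  have "farr (d f) u \<cdot> direct_arrow f X = (farr (d f) u \<cdot> c f (fobj (d f) X)) \<cdot> \<eta> f X"
    unfolding direct_arrow_def using assoc[OF unit_over[OF X] cX fu] by simp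
  also have "\<dots> = c f (fobj (d f) Y) \<cdot> (farr (pull f) (farr (d f) u) \<cdot> \<eta> f X)"
    using pull_square[OF f fu] assoc[OF unit_over[OF X] pull_over[OF f fu] cY] by simp
  also have "\<dots> = direct_arrow f Y \<cdot> u"
    unfolding direct_arrow_def
    using unit_natural[OF f u] assoc[OF u unit_over[OF Y] cY] by simp
  finally show ?thesis .
qed

text \<open>Moving the counit across the chosen Cartesian arrow leaves one side of the second
  triangle identity. Thus the counit is the vertical factor of \<open>c f Y\<close> through the
  co-Cartesian arrow out of \<open>f\<^sup>* Y\<close>.\<close>

lemma counit_direct_arrow:
  assumes f: "f \<in> hom A B B'" and Y: "Y \<in> Obj M" "fobj P Y = B'"
  shows "\<epsilon> f Y \<cdot> direct_arrow f (fobj (pull f) Y) = c f Y"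
proof -
  note Z = f pull_obj[OF f Y] and \<epsilon> = counit_over[OF f Y]
  note c = cleavage_arrow(2)[OF f direct_obj[OF Z]] and cY = cleavage_arrow(2)[OF f Y]
  have "\<epsilon> f Y \<cdot> direct_arrow f (fobj (pull f) Y) =
      c f Y \<cdot> (farr (pull f) (\<epsilon> f Y) \<cdot> \<eta> f (fobj (pull f) Y))"
    unfolding direct_arrow_def
    using assoc[OF unit_over[OF Z] c \<epsilon>] pull_square[OF f \<epsilon>]
      assoc[OF unit_over[OF Z] pull_over[OF f \<epsilon>] cY] by simp
  then show ?thesis using triangle(2)[OF f Y] unit_right[OF cY] by simp
qed

text \<open>The adjunction gives unique factorisation of arrows over \<open>f\<close> itself; arrows over \<open>w f\<close> are
  reduced to this case by first pulling back along \<open>w\<close>.\<close>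

lemma direct_arrow_cocartesian:
  assumes f: "f \<in> hom A B B'" and X: "X \<in> Obj M" "fobj P X = B"
  shows "cocartesian M A P (direct_arrow f X)"
proof (rule cocartesianI[OF direct_arrow_over[OF f X]])
  let ?i = "direct_arrow f X" and ?Y = "fobj (d f) X"
  note i = direct_arrow_over[OF f X] and Y = direct_obj[OF f X]
  \<comment> \<open>Uniqueness for vertical arrows: cancelling \<open>c f Z\<close> exhibits
    \<open>h\<close> as the transpose of \<open>v\<close> under the adjunction, and transposing back
    recovers \<open>v\<close> by counit naturality and the first triangle identity.\<close>
  have unique: "v = \<epsilon> f Z \<cdot> farr (d f) h"
    if v: "v \<in> hom_over (ident A B') ?Y Z" and h: "h \<in> hom_over (ident A B) X (fobj (pull f) Z)"
      and eq: "v \<cdot> ?i = c f Z \<cdot> h" for v h Z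
  proof -
    note vo = vertical_obj[OF v hom_obj(2)[OF f]]
    note cY = cleavage_arrow(2)[OF f Y] and cZ = cleavage_arrow[OF f vo(2,4)]
    note \<eta> = unit_over[OF f X] and fv = pull_over[OF f v]
    have B: "ident A B \<in> hom A B B" "ident A B' \<in> hom A B' B'"
      using A.ident_hom hom_obj[OF f] by auto
    have "c f Z \<cdot> (farr (pull f) v \<cdot> \<eta> f X) = c f Z \<cdot> h"
      using eq assoc[OF \<eta> cY v] assoc[OF \<eta> fv cZ(2)] pull_square[OF f v]
      unfolding direct_arrow_def by simp
    then have h_eq: "h = farr (pull f) v \<cdot> \<eta> f X"
      using cartesian_cancel[OF cZ over_comp_left[OF \<eta> fv B(1)] h] by simp
    have "farr (d f) h = farr (d f) (farr (pull f) v) \<cdot> farr (d f) (\<eta> f X)"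
      unfolding h_eq using adj(1)[OF f] hom_overD[OF \<eta>] hom_overD[OF fv]
      unfolding is_functor_def by (simp add: fibre_def)
    then have "\<epsilon> f Z \<cdot> farr (d f) h =
        (\<epsilon> f Z \<cdot> farr (d f) (farr (pull f) v)) \<cdot> farr (d f) (\<eta> f X)"
      using assoc[OF direct_over[OF f \<eta>] direct_over[OF f fv] counit_over[OF f vo(2,4)]] by simp
    also have "\<dots> = v \<cdot> (\<epsilon> f ?Y \<cdot> farr (d f) (\<eta> f X))"
      using counit_natural[OF f v] assoc[OF direct_over[OF f \<eta>] counit_over[OF f Y] v] by simp
    also have "\<dots> = v" using triangle(1)[OF f X] unit_right[OF v] by simp
    finally show ?thesis by simp
  qed
  fix Z h w assume h: "h \<in> hom_over (w \<cdot>\<^bsub>A\<^esub> f) X Z" and "w \<in> hom A (fobj P ?Y) (fobj P Z)"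
  then have w: "w \<in> hom A B' (fobj P Z)" using Y by simp
  have Z: "Z \<in> Obj M" "fobj P Z = fobj P Z" using hom_overD[OF h] by auto
  note W = pull_obj[OF w Z] and cw = cleavage_arrow[OF w Z]
  have "f \<in> hom A (fobj P X) (fobj P (fobj (pull w) Z))" using f X W by simp
  from cartesian_lift[OF cw h this] obtain h'
    where h': "h' \<in> hom_over f X (fobj (pull w) Z)" "c w Z \<cdot> h' = h" by blast
  note cf = cleavage_arrow[OF f W]
  \<comment> \<open>The part \<open>h'\<close> of \<open>h\<close> over \<open>f\<close> is factored
    once more, through \<open>c f\<close>, to obtain a vertical arrow \<open>g\<close> into
    \<open>f\<^sup>* w\<^sup>* Z\<close>. Its adjoint transpose is the vertical factor
    \<open>?v\<close>.\<close>
  obtain g where g: "g \<in> hom_over (ident A B) X (fobj (pull f) (fobj (pull w) Z))"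
      "c f (fobj (pull w) Z) \<cdot> g = h'"
    using cartesian_lift_vertical[OF cf h'(1) f] .
  let ?v = "\<epsilon> f (fobj (pull w) Z) \<cdot> farr (d f) g"
  have B': "ident A B' \<in> hom A B' B'" using A.ident_hom hom_obj[OF f] by auto
  note \<epsilon> = counit_over[OF f W] and dg = direct_over[OF f g(1)]
  note v = over_comp_left[OF dg \<epsilon> B']
  have vi: "?v \<cdot> ?i = h'"
    using assoc[OF i dg \<epsilon>] direct_arrow_natural[OF f g(1)] counit_direct_arrow[OF f W] g(2)
      assoc[OF g(1) direct_arrow_over[OF f pull_obj[OF f W]] \<epsilon>] by simp
  have cv: "c w Z \<cdot> ?v \<in> hom_over w ?Y Z" by (rule over_comp_right[OF v cw(2) w])
  show "\<exists>!v. v \<in> hom_over w ?Y Z \<and> v \<cdot> ?i = h"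
  proof (rule ex1I[of _ "c w Z \<cdot> ?v"])
    show "c w Z \<cdot> ?v \<in> hom_over w ?Y Z \<and> c w Z \<cdot> ?v \<cdot> ?i = h"
      using cv assoc[OF i v cw(2)] vi h'(2) by simp
    \<comment> \<open>A competitor \<open>y\<close> over \<open>w\<close> also factors through
      \<open>c w Z\<close>. Cancelling this Cartesian arrow leaves a vertical competitor, to which
      \<open>unique\<close> applies.\<close>
    fix y assume y: "y \<in> hom_over w ?Y Z \<and> y \<cdot> ?i = h"
    then obtain y' where y': "y' \<in> hom_over (ident A B') ?Y (fobj (pull w) Z)" "c w Z \<cdot> y' = y"
      using cartesian_lift_vertical[OF cw _ w] by metis
    have "c w Z \<cdot> (y' \<cdot> ?i) = c w Z \<cdot> h'"
      using y y'(2) assoc[OF i y'(1) cw(2)] h'(2) by simp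
    then have "y' \<cdot> ?i = h'"
      using cartesian_cancel[OF cw over_comp_left[OF i y'(1) f] h'(1)] by simp
    then have "y' = ?v" using unique[OF y'(1) g(1)] g(2) by simp
    then show "y = c w Z \<cdot> ?v" using y'(2) by simp
  qed
qed


section \<open>The base change morphism and the Chevalley condition\<close>

context
  fixes A\<^sub>0 A\<^sub>1 A\<^sub>2 a a\<^sub>1 a\<^sub>2
  assumes a: "a \<in> hom A A\<^sub>1 A\<^sub>0" and a1: "a\<^sub>1 \<in> hom A A\<^sub>2 A\<^sub>1" and a2: "a\<^sub>2 \<in> hom A A\<^sub>2 A\<^sub>1"
    and commutes: "a \<cdot>\<^bsub>A\<^esub> a\<^sub>1 = a \<cdot>\<^bsub>A\<^esub> a\<^sub>2"
begin

abbreviation bc :: "'o \<Rightarrow> 'm" where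
  "bc \<equiv> base_change M A P c d \<eta> \<epsilon> a a\<^sub>1 a\<^sub>2"

text \<open>By splitness both composites are the chosen Cartesian arrow over
  \<open>a \<cdot> a\<^sub>1 = a \<cdot> a\<^sub>2\<close>. Equal arrows have equal sources, which
  gives the strict equality of objects that lets the two whiskerings in \<open>\<chi>\<close> be
  composed.\<close>

lemma pull_pull:
  assumes Y: "Y \<in> Obj M" "fobj P Y = A\<^sub>0"
  shows "c a Y \<cdot> c a\<^sub>1 (fobj (pull a) Y) = c a Y \<cdot> c a\<^sub>2 (fobj (pull a) Y)"
    and "fobj (pull a\<^sub>1) (fobj (pull a) Y) = fobj (pull a\<^sub>2) (fobj (pull a) Y)"
proof -
  show eq: "c a Y \<cdot> c a\<^sub>1 (fobj (pull a) Y) = c a Y \<cdot> c a\<^sub>2 (fobj (pull a) Y)"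
    using cleavage_comp[OF a1 a Y] cleavage_comp[OF a2 a Y] commutes by simp
  note cY = cleavage_arrow(2)[OF a Y] and W = pull_obj[OF a Y]
  show "fobj (pull a\<^sub>1) (fobj (pull a) Y) = fobj (pull a\<^sub>2) (fobj (pull a) Y)"
    using hom_overD(4)[OF over_comp[OF cleavage_arrow(2)[OF a1 W] cY]]
      hom_overD(4)[OF over_comp[OF cleavage_arrow(2)[OF a2 W] cY]] eq by simp
qed

lemma base_change_eq:
  "bc X = \<epsilon> a\<^sub>2 (fobj (pull a) (fobj (d a) X)) \<cdot> farr (d a\<^sub>2) (farr (pull a\<^sub>1) (\<eta> a X))"
  by (simp add: base_change_def vcomp_def whisker_l_def whisker_r_def comp_func_def)

text \<open>The direct arrow for \<open>a\<^sub>2\<close> slides past the image of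
  \<open>\<eta>\<close> by naturality and then meets the counit, leaving the chosen Cartesian arrow
  over \<open>a\<^sub>2\<close>. The equation determines the component of \<open>\<chi>\<close>,
  because \<open>c a\<close> is Cartesian and the direct arrow co-Cartesian.\<close>

lemma
  assumes X: "X \<in> Obj M" "fobj P X = A\<^sub>1"
  shows base_change_over: "bc X \<in> hom_over (ident A A\<^sub>1)
        (fobj (d a\<^sub>2) (fobj (pull a\<^sub>1) X)) (fobj (pull a) (fobj (d a) X))"
    and base_change_direct_arrow:
      "c a (fobj (d a) X) \<cdot> (bc X \<cdot> direct_arrow a\<^sub>2 (fobj (pull a\<^sub>1) X)) =
        direct_arrow a X \<cdot> c a\<^sub>1 X"
proof -
  let ?Y = "fobj (d a) X" and ?Z = "fobj (pull a) (fobj (d a) X)" and ?W = "fobj (pull a\<^sub>1) X"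
  note Y = direct_obj[OF a X] and Z = pull_obj[OF a direct_obj[OF a X]]
  note \<eta> = unit_over[OF a X] and cY = cleavage_arrow(2)[OF a Y]
  note p\<eta> = pull_over[OF a1 \<eta>]
  \<comment> \<open>The same arrow with its target read as
    \<open>a\<^sub>2\<^sup>* a\<^sup>* a\<^sub>* X\<close>, so that the direct image along
    \<open>a\<^sub>2\<close> can be followed by the counit of \<open>a\<^sub>2\<close>.\<close>
  note p\<eta>2 = p\<eta>[unfolded pull_pull(2)[OF Y]]
  note dp\<eta> = direct_over[OF a2 p\<eta>2]
  note W = pull_obj[OF a1 X] and V = pull_obj[OF a2 Z]
  note \<epsilon> = counit_over[OF a2 Z]
  have id: "ident A A\<^sub>1 \<in> hom A A\<^sub>1 A\<^sub>1" using A.ident_hom hom_obj[OF a] by blast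
  show "bc X \<in> hom_over (ident A A\<^sub>1) (fobj (d a\<^sub>2) ?W) ?Z"
    unfolding base_change_eq by (rule over_comp_left[OF dp\<eta> \<epsilon> id])
  have "bc X \<cdot> direct_arrow a\<^sub>2 ?W =
      (\<epsilon> a\<^sub>2 ?Z \<cdot> direct_arrow a\<^sub>2 (fobj (pull a\<^sub>2) ?Z)) \<cdot> farr (pull a\<^sub>1) (\<eta> a X)"
    unfolding base_change_eq
    using assoc[OF direct_arrow_over[OF a2 W] dp\<eta> \<epsilon>] direct_arrow_natural[OF a2 p\<eta>2]
      assoc[OF p\<eta>2 direct_arrow_over[OF a2 V] \<epsilon>] by simp
  also have "\<dots> = c a\<^sub>2 ?Z \<cdot> farr (pull a\<^sub>1) (\<eta> a X)"
    using counit_direct_arrow[OF a2 Z] by simp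
  finally have "c a ?Y \<cdot> (bc X \<cdot> direct_arrow a\<^sub>2 ?W) =
      (c a ?Y \<cdot> c a\<^sub>2 ?Z) \<cdot> farr (pull a\<^sub>1) (\<eta> a X)"
    using assoc[OF p\<eta>2 cleavage_arrow(2)[OF a2 Z] cY] by simp
  \<comment> \<open>Commutativity of the base square enters here: after \<open>c a ?Y\<close>, the
    chosen arrow over \<open>a\<^sub>2\<close> may be traded for the one over
    \<open>a\<^sub>1\<close>.\<close>
  also have "\<dots> = c a ?Y \<cdot> (c a\<^sub>1 ?Z \<cdot> farr (pull a\<^sub>1) (\<eta> a X))"
    using pull_pull(1)[OF Y] assoc[OF p\<eta> cleavage_arrow(2)[OF a1 Z] cY] by simp
  also have "\<dots> = direct_arrow a X \<cdot> c a\<^sub>1 X"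
    unfolding direct_arrow_def
    using pull_square[OF a1 \<eta>] assoc[OF cleavage_arrow(2)[OF a1 X] \<eta> cY] by simp
  finally show "c a ?Y \<cdot> (bc X \<cdot> direct_arrow a\<^sub>2 ?W) = direct_arrow a X \<cdot> c a\<^sub>1 X" .
qed

text \<open>Both sides are tested between the co-Cartesian \<open>?iX\<close> and the Cartesian
  \<open>c a\<close>, where \<open>base_change_direct_arrow\<close> rewrites them in terms of direct
  arrows and the chosen arrows over \<open>a\<^sub>1\<close>. This avoids comparing the functors
  \<open>a\<^sub>1\<^sup>* a\<^sup>*\<close> and \<open>a\<^sub>2\<^sup>* a\<^sup>*\<close> on
  arrows.\<close>

lemma base_change_natural:
  assumes u: "u \<in> hom_over (ident A A\<^sub>1) X Y"
  shows "bc Y \<cdot> farr (d a\<^sub>2) (farr (pull a\<^sub>1) u) = farr (pull a) (farr (d a) u) \<cdot> bc X"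
proof -
  let ?iX = "direct_arrow a\<^sub>2 (fobj (pull a\<^sub>1) X)" and ?iY = "direct_arrow a\<^sub>2 (fobj (pull a\<^sub>1) Y)"
  note uo = vertical_obj[OF u hom_obj(1)[OF a]]
  note X = uo(1,3) and Y = uo(2,4)
  have id: "ident A A\<^sub>1 \<in> hom A A\<^sub>1 A\<^sub>1" using A.ident_hom hom_obj[OF a] by blast
  note iX = direct_arrow_over[OF a2 pull_obj[OF a1 X]] and iY = direct_arrow_over[OF a2 pull_obj[OF a1 Y]]
  note pu = pull_over[OF a1 u] and du = direct_over[OF a u]
  note dpu = direct_over[OF a2 pu] and pdu = pull_over[OF a du]
  note bX = base_change_over[OF X] and bY = base_change_over[OF Y]
  note cX = cleavage_arrow(2)[OF a direct_obj[OF a X]] and cY = cleavage_arrow[OF a direct_obj[OF a Y]]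
  note l = over_comp_left[OF dpu bY id] and r = over_comp_left[OF bX pdu id]
  have "c a (fobj (d a) Y) \<cdot> ((bc Y \<cdot> farr (d a\<^sub>2) (farr (pull a\<^sub>1) u)) \<cdot> ?iX) =
      (c a (fobj (d a) Y) \<cdot> (bc Y \<cdot> ?iY)) \<cdot> farr (pull a\<^sub>1) u"
    using assoc[OF iX dpu bY] direct_arrow_natural[OF a2 pu] assoc[OF pu iY bY]
      assoc[OF pu over_comp_left[OF iY bY a2] cY(2)] by simp
  also have "\<dots> = (direct_arrow a Y \<cdot> u) \<cdot> c a\<^sub>1 X"
    using base_change_direct_arrow[OF Y] pull_square[OF a1 u]
      assoc[OF pu cleavage_arrow(2)[OF a1 Y] direct_arrow_over[OF a Y]]
      assoc[OF cleavage_arrow(2)[OF a1 X] u direct_arrow_over[OF a Y]] by simp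
  also have "\<dots> = farr (d a) u \<cdot> (c a (fobj (d a) X) \<cdot> (bc X \<cdot> ?iX))"
    using direct_arrow_natural[OF a u] base_change_direct_arrow[OF X]
      assoc[OF cleavage_arrow(2)[OF a1 X] direct_arrow_over[OF a X] du] by simp
  also have "\<dots> = c a (fobj (d a) Y) \<cdot> ((farr (pull a) (farr (d a) u) \<cdot> bc X) \<cdot> ?iX)"
    using pull_square[OF a du] assoc[OF over_comp_left[OF iX bX a2] cX du]
      assoc[OF over_comp_left[OF iX bX a2] pdu cY(2)] assoc[OF iX bX pdu] by simp
  finally have "(bc Y \<cdot> farr (d a\<^sub>2) (farr (pull a\<^sub>1) u)) \<cdot> ?iX =
      (farr (pull a) (farr (d a) u) \<cdot> bc X) \<cdot> ?iX"
    by (rule cartesian_cancel[OF cY over_comp_left[OF iX l a2] over_comp_left[OF iX r a2]])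
  then show ?thesis
    by (rule cocartesian_cancel[OF direct_arrow_cocartesian[OF a2 pull_obj[OF a1 X]] iX l r])
qed

lemma base_change_nat_trans:
  "nat_trans (fibre M A P A\<^sub>1) (fibre M A P A\<^sub>1) (d a\<^sub>2 \<odot> pull a\<^sub>1) (pull a \<odot> d a) bc"
  unfolding nat_trans_def
proof (intro conjI ballI)
  show "is_functor (fibre M A P A\<^sub>1) (fibre M A P A\<^sub>1) (d a\<^sub>2 \<odot> pull a\<^sub>1)"
    by (rule is_functor_comp[OF adj(2)[OF a1] adj(1)[OF a2]])
  show "is_functor (fibre M A P A\<^sub>1) (fibre M A P A\<^sub>1) (pull a \<odot> d a)"
    by (rule is_functor_comp[OF adj(1)[OF a] adj(2)[OF a]])
next
  fix X assume "X \<in> Obj (fibre M A P A\<^sub>1)"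
  then show "bc X \<in> hom (fibre M A P A\<^sub>1) (fobj (d a\<^sub>2 \<odot> pull a\<^sub>1) X) (fobj (pull a \<odot> d a) X)"
    using base_change_over[of X] by (simp add: comp_func_def)
next
  fix u assume "u \<in> Arr (fibre M A P A\<^sub>1)"
  then have "u \<in> hom_over (ident A A\<^sub>1) (src M u) (tgt M u)"
    unfolding fibre_def hom_over_def hom_def by simp
  from base_change_natural[OF this]
  show "bc (tgt (fibre M A P A\<^sub>1) u) \<cdot>\<^bsub>fibre M A P A\<^sub>1\<^esub> farr (d a\<^sub>2 \<odot> pull a\<^sub>1) u =
      farr (pull a \<odot> d a) u \<cdot>\<^bsub>fibre M A P A\<^sub>1\<^esub> bc (src (fibre M A P A\<^sub>1) u)"
    by (simp add: comp_func_def)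
qed

text \<open>The direct arrow is co-Cartesian, and following a co-Cartesian arrow by a vertical one
  preserves this property exactly when the vertical one is invertible.\<close>

lemma base_change_iso_iff:
  assumes X: "X \<in> Obj M" "fobj P X = A\<^sub>1"
  shows "is_iso (fibre M A P A\<^sub>1) (bc X) \<longleftrightarrow>
    cocartesian M A P (bc X \<cdot> direct_arrow a\<^sub>2 (fobj (pull a\<^sub>1) X))"
proof -
  note W = pull_obj[OF a1 X] and b = base_change_over[OF X]
  note i = direct_arrow_cocartesian[OF a2 W] direct_arrow_over[OF a2 W]
  show ?thesis
    using cocartesian_iso_comp[OF i a2 _ b] cocartesian_comparison_iso[OF i a2 b] by blast
qed

definition chevalley :: bool where
  "chevalley \<longleftrightarrow> (\<forall>M\<^sub>1' M\<^sub>1 M\<^sub>0' M\<^sub>0 k\<^sub>1 k\<^sub>0 \<chi>' \<kappa>.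
     k\<^sub>1 \<in> hom_over a\<^sub>2 M\<^sub>1' M\<^sub>1 \<longrightarrow> \<chi>' \<in> hom_over a\<^sub>1 M\<^sub>1' M\<^sub>0' \<longrightarrow>
     \<kappa> \<in> hom_over a M\<^sub>1 M\<^sub>0 \<longrightarrow> k\<^sub>0 \<in> hom_over a M\<^sub>0' M\<^sub>0 \<longrightarrow> \<kappa> \<cdot> k\<^sub>1 = k\<^sub>0 \<cdot> \<chi>' \<longrightarrow>
     cartesian M A P \<kappa> \<longrightarrow> cartesian M A P \<chi>' \<longrightarrow> cocartesian M A P k\<^sub>0 \<longrightarrow>
     cocartesian M A P k\<^sub>1)"

text \<open>Condition (C) is applied to the canonical square on \<open>X\<close>, whose
  commutativity is \<open>base_change_direct_arrow\<close>.\<close>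

lemma chevalley_imp_iso:
  assumes "chevalley" and X: "X \<in> Obj M" "fobj P X = A\<^sub>1"
  shows "is_iso (fibre M A P A\<^sub>1) (bc X)"
proof -
  note Y = direct_obj[OF a X] and W = pull_obj[OF a1 X]
  note k1 = over_comp_left[OF direct_arrow_over[OF a2 W] base_change_over[OF X] a2]
  show ?thesis
    unfolding base_change_iso_iff[OF X]
    using assms(1)[unfolded chevalley_def, rule_format, OF k1 cleavage_arrow(2)[OF a1 X]
        cleavage_arrow(2)[OF a Y] direct_arrow_over[OF a X] base_change_direct_arrow[OF X]
        cleavage_arrow(1)[OF a Y] cleavage_arrow(1)[OF a1 X] direct_arrow_cocartesian[OF a X]] .
qed

text \<open>An arbitrary square is identified with the canonical one on \<open>M\<^sub>0'\<close> by vertical isomorphisms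
  \<open>s : M\<^sub>1' \<rightarrow> a\<^sub>1\<^sup>* M\<^sub>0'\<close>, \<open>t : a\<^sub>* M\<^sub>0' \<rightarrow> M\<^sub>0\<close> and \<open>r : a\<^sup>* a\<^sub>* M\<^sub>0' \<rightarrow> M\<^sub>1\<close>.\<close>

lemma iso_imp_chevalley:
  assumes iso: "\<And>X. X \<in> Obj M \<Longrightarrow> fobj P X = A\<^sub>1 \<Longrightarrow> is_iso (fibre M A P A\<^sub>1) (bc X)"
  shows "chevalley"
  unfolding chevalley_def
proof (intro allI impI)
  fix M\<^sub>1' M\<^sub>1 M\<^sub>0' M\<^sub>0 k\<^sub>1 k\<^sub>0 \<chi>' \<kappa>
  assume k1: "k\<^sub>1 \<in> hom_over a\<^sub>2 M\<^sub>1' M\<^sub>1" and \<chi>': "\<chi>' \<in> hom_over a\<^sub>1 M\<^sub>1' M\<^sub>0'"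
    and \<kappa>: "\<kappa> \<in> hom_over a M\<^sub>1 M\<^sub>0" and k0: "k\<^sub>0 \<in> hom_over a M\<^sub>0' M\<^sub>0"
    and sq: "\<kappa> \<cdot> k\<^sub>1 = k\<^sub>0 \<cdot> \<chi>'"
    and cart: "cartesian M A P \<kappa>" "cartesian M A P \<chi>'" and cocart: "cocartesian M A P k\<^sub>0"
  have X: "M\<^sub>0' \<in> Obj M" "fobj P M\<^sub>0' = A\<^sub>1" using hom_overD(6)[OF k0] over_obj[OF k0 a] by auto
  let ?Y = "fobj (d a) M\<^sub>0'" and ?W = "fobj (pull a\<^sub>1) M\<^sub>0'"
  let ?i = "direct_arrow a M\<^sub>0'" and ?i2 = "direct_arrow a\<^sub>2 ?W"
  note Y = direct_obj[OF a X] and W = pull_obj[OF a1 X]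
  note i = direct_arrow_over[OF a X] and i2 = direct_arrow_over[OF a2 W]
  note c1 = cleavage_arrow[OF a1 X] and cY = cleavage_arrow[OF a Y]
  note b = base_change_over[OF X]
  note bi = over_comp_left[OF i2 b a2]
  obtain s where s: "s \<in> hom_over (ident A A\<^sub>2) M\<^sub>1' ?W" "c a\<^sub>1 M\<^sub>0' \<cdot> s = \<chi>'"
    using cartesian_lift_vertical[OF c1 \<chi>' a1] .
  obtain t where t: "t \<in> hom_over (ident A A\<^sub>0) ?Y M\<^sub>0" "t \<cdot> ?i = k\<^sub>0"
    using cocartesian_lift_vertical[OF direct_arrow_cocartesian[OF a X] i k0 a] .
  have s_iso: "is_iso (fibre M A P A\<^sub>2) s"
    using cartesian_comparison_iso[OF c1 a1 s(1)] cart(2) s(2) by simp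
  have t_iso: "is_iso (fibre M A P A\<^sub>0) t"
    using cocartesian_comparison_iso[OF direct_arrow_cocartesian[OF a X] i a t(1)] cocart t(2)
    by simp
  note tc = over_comp_left[OF cY(2) t(1) a]
  \<comment> \<open>Both \<open>\<kappa>\<close> and \<open>t \<cdot> c a ?Y\<close> are Cartesian
    over \<open>a\<close> with target \<open>M\<^sub>0\<close>, the latter because \<open>t\<close>
    is invertible; \<open>r\<close> is the comparison between them.\<close>
  obtain r where r: "r \<in> hom_over (ident A A\<^sub>1) (fobj (pull a) ?Y) M\<^sub>1"
      "\<kappa> \<cdot> r = t \<cdot> c a ?Y"
    using cartesian_lift_vertical[OF cart(1) \<kappa> tc a] .
  have r_iso: "is_iso (fibre M A P A\<^sub>1) r"
    using cartesian_comparison_iso[OF cart(1) \<kappa> a r(1)] r(2)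
      cartesian_iso_comp[OF cY a t_iso t(1)] by simp
  note bis = over_comp_right[OF s(1) bi a2]
  note rbis = over_comp_left[OF bis r(1) a2]
  \<comment> \<open>\<open>k\<^sub>1\<close> is recovered as the canonical top arrow conjugated by
    \<open>s\<close> and \<open>r\<close>. Equality is checked after \<open>\<kappa>\<close>, which
    is Cartesian, by passing through the canonical square to the given one.\<close>
  have "\<kappa> \<cdot> (r \<cdot> ((bc M\<^sub>0' \<cdot> ?i2) \<cdot> s)) = t \<cdot> ((c a ?Y \<cdot> (bc M\<^sub>0' \<cdot> ?i2)) \<cdot> s)"
    using assoc[OF bis r(1) \<kappa>] r(2) assoc[OF bis cY(2) t(1)] assoc[OF s(1) bi cY(2)] by simp
  also have "\<dots> = t \<cdot> (?i \<cdot> \<chi>')"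
    using base_change_direct_arrow[OF X] assoc[OF s(1) c1(2) i] s(2) by simp
  also have "\<dots> = \<kappa> \<cdot> k\<^sub>1"
    using assoc[OF \<chi>' i t(1)] t(2) sq by simp
  finally have k1_eq: "r \<cdot> ((bc M\<^sub>0' \<cdot> ?i2) \<cdot> s) = k\<^sub>1"
    by (rule cartesian_cancel[OF cart(1) \<kappa> rbis k1])
  have "cocartesian M A P (bc M\<^sub>0' \<cdot> ?i2)"
    using iso[OF X] base_change_iso_iff[OF X] by blast
  from cocartesian_comp_iso[OF this bi a2 s_iso s(1)]
  show "cocartesian M A P k\<^sub>1"
    using cocartesian_iso_comp[OF _ bis a2 r_iso r(1)] k1_eq by simp
qed

theorem exchange_iff_chevalley:
  "nat_iso (fibre M A P A\<^sub>1) (fibre M A P A\<^sub>1) (d a\<^sub>2 \<odot> pull a\<^sub>1) (pull a \<odot> d a) bc \<longleftrightarrow> chevalley"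
  unfolding nat_iso_iff
  using base_change_nat_trans chevalley_imp_iso iso_imp_chevalley by auto

end

end

theorem lemma0p2p2:
  fixes M :: "('o, 'm) cat" and A :: "('p, 'q) cat" and P :: "('o, 'm, 'p, 'q) func"
    and c :: "'q \<Rightarrow> 'o \<Rightarrow> 'm" and d :: "'q \<Rightarrow> ('o, 'm, 'o, 'm) func"
    and \<eta> \<epsilon> :: "'q \<Rightarrow> 'o \<Rightarrow> 'm"
    and A\<^sub>0 A\<^sub>1 A\<^sub>2 :: 'p and a a\<^sub>1 a\<^sub>2 :: 'q
  assumes "bifibration M A P"
    and "split_cleavage M A P c"
    and "direct_images M A P c d \<eta> \<epsilon>"
    and "a \<in> hom A A\<^sub>1 A\<^sub>0" and "a\<^sub>1 \<in> hom A A\<^sub>2 A\<^sub>1" and "a\<^sub>2 \<in> hom A A\<^sub>2 A\<^sub>1"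
    and "a \<cdot>\<^bsub>A\<^esub> a\<^sub>1 = a \<cdot>\<^bsub>A\<^esub> a\<^sub>2"
  shows "nat_iso (fibre M A P A\<^sub>1) (fibre M A P A\<^sub>1)
           (d a\<^sub>2 \<odot> inverse_image M A P c a\<^sub>1) (inverse_image M A P c a \<odot> d a)
           (base_change M A P c d \<eta> \<epsilon> a a\<^sub>1 a\<^sub>2)
     \<longleftrightarrow>
         (\<forall>M\<^sub>1' M\<^sub>1 M\<^sub>0' M\<^sub>0 k\<^sub>1 k\<^sub>0 \<chi>' \<kappa>.
            k\<^sub>1 \<in> hom M M\<^sub>1' M\<^sub>1 \<longrightarrow> \<chi>' \<in> hom M M\<^sub>1' M\<^sub>0' \<longrightarrow>
            \<kappa> \<in> hom M M\<^sub>1 M\<^sub>0 \<longrightarrow> k\<^sub>0 \<in> hom M M\<^sub>0' M\<^sub>0 \<longrightarrow>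
            \<kappa> \<cdot>\<^bsub>M\<^esub> k\<^sub>1 = k\<^sub>0 \<cdot>\<^bsub>M\<^esub> \<chi>' \<longrightarrow>
            farr P k\<^sub>1 = a\<^sub>2 \<longrightarrow> farr P \<chi>' = a\<^sub>1 \<longrightarrow> farr P \<kappa> = a \<longrightarrow> farr P k\<^sub>0 = a \<longrightarrow>
            cartesian M A P \<kappa> \<longrightarrow> cartesian M A P \<chi>' \<longrightarrow> cocartesian M A P k\<^sub>0 \<longrightarrow>
            cocartesian M A P k\<^sub>1)"
proof -
  interpret functor_over M A P
    using assms(1) by unfold_locales (simp add: bifibration_def fibration_def)
  interpret bifibred M A P c d \<eta> \<epsilon>
    using assms(2,3) by unfold_locales
  show ?thesis
    \<comment> \<open>After unfolding \<open>hom_over\<close>, the two forms of condition (C) differ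
      only in how the premises are grouped and ordered under the same quantifiers.\<close>
    unfolding exchange_iff_chevalley[OF assms(4-7)] chevalley_def[OF assms(4-7)] hom_over_def
    by (intro iff_allI) blast
qed

end
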